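(* Let $K:[0,\infty)\to\mathbb{R}$ be nonnegative with $K(0)=0$, bounded, having a right limit $K(0+)$ at zero and, if $K(0+)=0$, a finite right derivative at zero, and lower semicontinuous on $(0,\infty)$, i.e. $K(\tilde\xi)\le\liminf_{\xi\to\tilde\xi}K(\xi)$ for all $\tilde\xi>0$. Let $h:\mathbb{R}\to\mathbb{R}$ be convex with $h(0)=0$, continuously differentiable on $\mathbb{R}\setminus\{0\}$, with $h'(z)>0$ for $z>0$ and $h'(z)<0$ for $z<0$, and polynomially bounded, i.e. there exist a positive integer $a$ and $b_0,b_1>0$ with $h(z)\le b_0+b_1|z|^a$ for all $z\in\mathbb{R}$. Let $\mu,\sigma>0$, $k\ge0$, $\lambda=2\mu/\sigma^2$, $\ell=\liminf_{\xi\downarrow0}K(\xi)/\xi\in[0,\infty]$, and for $s\le S$ let $$\gamma(s,S)=\begin{cases}k\mu+\dfrac{K(S-s)\mu}{S-s}+\dfrac{\lambda}{S-s}\displaystyle\int_s^S\int_0^\infty h(u+y)e^{-\lambda u}\,du\,dy & \text{if }s<S,\\[2mm](k+\ell)\mu+\lambda\displaystyle\int_0^\infty h(u+s)e^{-\lambda u}\,du&\text{if }s=S.\end{cases}$$ Then there exists $(s^\star,S^\star)\in\mathbb{R}^2$ with $s^\star\le S^\star$ such that $\gamma(s^\star,S^\star)=\inf\{\gamma(s,S):s\le S\}$. The equation $$\lambda\int_0^\infty h(u+z^\star)e^{-\lambda u}\,du=h(z^\star)$$ has a unique solution $z^\star\in\mathbb{R}$, and $z^\star<0$. If $K(0+)>0$,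 any such minimizer satisfies $s^\star<z^\star<S^\star$; if $K(0+)=0$, any such minimizer satisfies either $s^\star<z^\star<S^\star$ or $s^\star=z^\star=S^\star$.
   Context: If $K(0+)>0$ then $\ell=\infty$, and $\gamma(s,s)=\infty$ for every $s$. If $K(0+)=0$ then $\ell$ is the (finite) right derivative of $K$ at zero. *)

theory Defs
  imports "HOL-Analysis.Analysis"
begin

(* Liminf along at_right 0 uses K only at positive arguments.  The value lies in ereal
   because it is infinite when K has a positive right limit at 0. *)
definition ell :: "(real \<Rightarrow> real) \<Rightarrow> ereal" where
  "ell K = Liminf (at_right 0) (\<lambda>\<xi>. ereal (K \<xi> / \<xi>))"

(* Only meaningful for s <= S, so the second branch is the case s = S.
   With h continuous, nonnegative and polynomially bounded, all integrands are Lebesgue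
   integrable, so the default value 0 of divergent integrals is never used. *)
definition gamma_cost ::
  "(real \<Rightarrow> real) \<Rightarrow> (real \<Rightarrow> real) \<Rightarrow> real \<Rightarrow> real \<Rightarrow> real \<Rightarrow> real \<Rightarrow> real \<Rightarrow> ereal" where
  "gamma_cost K h k \<mu> lam s S =
     (if s < S then
        ereal (k * \<mu> + K (S - s) * \<mu> / (S - s) +
          lam / (S - s) * (LBINT y:{s..S}. (LBINT u:{0..}. h (u + y) * exp (- lam * u))))
      else
        (ereal k + ell K) * ereal \<mu> +
          ereal (lam * (LBINT u:{0..}. h (u + s) * exp (- lam * u))))"

definition gamma_minimizer :: "(real \<Rightarrow> real \<Rightarrow> ereal) \<Rightarrow> real \<Rightarrow> real \<Rightarrow> bool" where
  "gamma_minimizer \<gamma> s S \<longleftrightarrow>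
     s \<le> S \<and> \<gamma> s S = Inf {\<gamma> s' S' | s' S'. s' \<le> S'}"

end

theory Submission
  imports Defs
begin

text \<open>
  Let g(y) be the inner integral, normalised by the factor lam. It is convex, being an average of
  translates of h, and g' = lam (g - h), so g - h is nondecreasing. It is positive at 0, negative
  somewhere on the left because h is unbounded there, and it cannot vanish on a whole interval, since
  g and hence h would be constant on that interval. So g - h has a unique zero z < 0, and g is strictly
  decreasing before z and strictly increasing after z.

  The cost is lower semicontinuous (on the diagonal this is what the lower limit in \<open>ell\<close> provides)
  and, since g grows at least linearly at both ends, has bounded sublevel sets, so a minimizer exists.
  If s < S, translating the interval leaves the K-terms unchanged, and stationarity of the average of g
  under translation gives g(s) = g(S), hence s < z < S. If s = S, finiteness of the minimum forces
  \<open>ell K\<close> to be finite, and comparison with the other diagonal points gives s = z.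
\<close>

subsection \<open>Integrals, convexity and semicontinuity\<close>

text \<open>A single term of the exponential series is at most the whole sum. This turns the
  polynomial growth of \<open>h\<close> into exponential growth.\<close>

lemma exp_ge_power_div_fact:
  fixes x :: real
  assumes "0 \<le> x"
  shows "x ^ n / fact n \<le> exp x"
proof -
  have "summable (\<lambda>i. x ^ i /\<^sub>R fact i)"
    by (rule summable_exp_generic)
  then have "(\<Sum>i\<in>{n}. x ^ i /\<^sub>R fact i) \<le> (\<Sum>i. x ^ i /\<^sub>R fact i)"
    by (rule sum_le_suminf) (use assms in auto)
  then show ?thesis
    by (simp add: exp_def divide_inverse mult.commute)
qed

lemma set_integrable_exp_minus_atLeast:
  fixes c y :: real
  assumes "c > 0"
  shows "set_integrable lborel {y..} (\<lambda>x. exp (- c * x))"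
proof -
  have "set_integrable lebesgue {y..} (\<lambda>x. exp (- c * x))"
    using integrable_on_exp_minus_to_infinity[OF assms, of y]
    by (intro nonnegative_absolutely_integrable_1) auto
  then show ?thesis
    unfolding set_integrable_def by (subst (asm) integrable_completion) auto
qed

text \<open>Without a minimum, every point of \<open>T\<close> lies strictly above the value of
  another one, so the open sets \<open>U p\<close> cover \<open>T\<close>; the index of least value
  in a finite subcover gives the contradiction. Semicontinuity is demanded relative to
  \<open>T\<close>, as the cost is meaningful only for \<open>s \<le> S\<close>.\<close>

lemma compact_lower_semicontinuous_attains_min:
  fixes F :: "'a::topological_space \<Rightarrow> 'b::{linorder, dense_order}"
  assumes "compact T" "T \<noteq> {}"
    and lsc: "\<And>p c. p \<in> T \<Longrightarrow> c < F p \<Longrightarrow> \<exists>U. open U \<and> p \<in> U \<and> (\<forall>q\<in>U \<inter> T. c < F q)"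
  shows "\<exists>p\<in>T. \<forall>q\<in>T. F p \<le> F q"
proof (rule ccontr)
  assume no_min: "\<not> ?thesis"
  define U where "U p = \<Union>{V. open V \<and> (\<forall>q\<in>V \<inter> T. F p < F q)}" for p
  have "open (U p)" for p
    unfolding U_def by blast
  moreover have "T \<subseteq> (\<Union>p\<in>T. U p)"
  proof
    fix q assume "q \<in> T"
    with no_min obtain p where "p \<in> T" "F p < F q"
      by (auto simp: not_le)
    moreover from lsc[OF \<open>q \<in> T\<close> this(2)]
    have "q \<in> U p"
      unfolding U_def by blast
    ultimately show "q \<in> (\<Union>p\<in>T. U p)"
      by blast
  qed
  ultimately obtain A where A: "A \<subseteq> T" "finite A" "T \<subseteq> (\<Union>p\<in>A. U p)"
    using compactE_image[OF \<open>compact T\<close>, of T U] by metis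
  from A \<open>T \<noteq> {}\<close> have "A \<noteq> {}" by auto
  then obtain p where p: "p \<in> A" "\<And>q. q \<in> A \<Longrightarrow> F p \<le> F q"
    using \<open>finite A\<close> by (metis arg_min_if_finite(1) arg_min_least)
  with A obtain q where "q \<in> A" "p \<in> U q" "p \<in> T"
    by blast
  then have "F q < F p"
    unfolding U_def by blast
  with p(2)[OF \<open>q \<in> A\<close>] show False
    by simp
qed

text \<open>One antiderivative on the whole line turns integrals over varying intervals into
  differences of a single function.\<close>

lemma ex_antiderivative:
  fixes f :: "real \<Rightarrow> real"
  assumes "continuous_on UNIV f"
  shows "\<exists>F. \<forall>x. (F has_real_derivative f x) (at x)"
proof -
  have "\<exists>F. \<forall>x::real. -\<infinity> < ereal x \<longrightarrow> ereal x < \<infinity> \<longrightarrow> (F has_vector_derivative f x) (at x)"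
    using assms by (intro einterval_antiderivative) (auto simp: continuous_on_eq_continuous_at)
  then show ?thesis
    by (simp add: has_real_derivative_iff_has_vector_derivative)
qed

lemma set_lebesgue_integral_FTC:
  fixes f :: "real \<Rightarrow> real"
  assumes "\<And>x. (F has_real_derivative f x) (at x)" "continuous_on UNIV f" "a \<le> b"
  shows "(LBINT x:{a..b}. f x) = F b - F a"
proof -
  have "continuous_on {a..b} f"
    using assms(2) continuous_on_subset by blast
  then show ?thesis
    using integral_FTC_Icc_real[of a b F f] assms
    by (simp add: set_lebesgue_integral_def mult.commute continuous_on_eq_continuous_at)
qed

text \<open>Add the tangent inequalities at the two points.\<close>

lemma convex_on_deriv_mono:
  fixes f :: "real \<Rightarrow> real"
  assumes "convex_on UNIV f" "x \<le> y"
    and "(f has_real_derivative d) (at x)" "(f has_real_derivative e) (at y)"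
  shows "d \<le> e"
proof (cases "x = y")
  case True
  with assms show ?thesis
    using DERIV_unique by blast
next
  case False
  have "d * (y - x) \<le> f y - f x" "e * (x - y) \<le> f x - f y"
    using assms by (auto intro!: convex_on_imp_above_tangent[of UNIV])
  then have "0 \<le> (e - d) * (y - x)"
    by (simp add: algebra_simps)
  with False \<open>x \<le> y\<close> show ?thesis
    by (auto simp: zero_le_mult_iff)
qed

subsection \<open>The discounted running cost\<close>

text \<open>The sign conditions on the derivative of \<open>h\<close> enter through
  \<open>h_pos\<close>, which \<open>positive_off_zero\<close> supplies.\<close>

locale running_cost =
  fixes h :: "real \<Rightarrow> real" and lam b0 b1 :: real and a :: nat
  assumes lam_pos: "lam > 0"
    and h_convex: "convex_on UNIV h"
    and h_zero: "h 0 = 0"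
    and h_pos: "x \<noteq> 0 \<Longrightarrow> h x > 0"
    and b0_nonneg: "b0 \<ge> 0" and b1_nonneg: "b1 \<ge> 0"
    and h_poly: "h x \<le> b0 + b1 * \<bar>x\<bar> ^ a"
begin

section \<open>Shape and integrability of the running cost\<close>

lemma h_nonneg: "h x \<ge> 0"
  using h_pos[of x] h_zero by (cases "x = 0") auto

lemma continuous_on_h: "continuous_on S h"
  using convex_on_continuous[OF open_UNIV h_convex] continuous_on_subset by blast

lemma h_scale:
  assumes "0 \<le> t" "t \<le> 1"
  shows "h (t * x) \<le> t * h x"
  using convex_onD[OF h_convex, of t 0 x] assms by (simp add: h_zero)

lemma h_strict_decreasing:
  assumes "x < y" "y \<le> 0"
  shows "h y < h x"
proof (cases "y = 0")
  case True
  with assms h_pos[of x] h_zero show ?thesis by simp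
next
  case False
  with assms have t: "0 \<le> y / x" "y / x < 1"
    by (auto simp: divide_simps)
  have "h y \<le> y / x * h x"
    using h_scale[of "y / x" x] t assms by simp
  also have "\<dots> < 1 * h x"
    using t h_pos[of x] assms by (intro mult_strict_right_mono) auto
  finally show ?thesis by simp
qed

lemma h_unbounded: "\<exists>x<0. h x > B"
proof -
  \<comment> \<open>A scale with \<open>n * h (-1) > B\<close>; convexity and \<open>h 0 = 0\<close>
    make \<open>h (-n)\<close> at least that large.\<close>
  define n where "n = max 1 (B / h (-1) + 1)"
  have n: "n \<ge> 1" "B < n * h (-1)"
    using h_pos[of "-1"] by (auto simp: n_def max_def field_simps)
  have "h (-1) \<le> h (-n) / n"
    using h_scale[of "1/n" "-n"] n by simp
  with n have "B < h (-n)"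
    by (simp add: field_simps)
  with n show ?thesis
    by (intro exI[of _ "-n"]) auto
qed

text \<open>Half of the decay rate absorbs the polynomial growth of \<open>h\<close>; the other half
  remains as an integrable majorant.\<close>

lemma set_integrable_h_exp: "set_integrable lborel {y..} (\<lambda>x. h x * exp (- lam * x))"
proof -
  define C where "C = (b0 + b1 * fact a * (2 / lam) ^ a) * exp (lam * \<bar>y\<bar>)"
  have bound: "h x * exp (- lam * x) \<le> C * exp (- (lam / 2) * x)" if "y \<le> x" for x
  proof -
    have "(lam / 2 * \<bar>x\<bar>) ^ a / fact a \<le> exp (lam / 2 * \<bar>x\<bar>)"
      using lam_pos by (intro exp_ge_power_div_fact) auto
    then have *: "\<bar>x\<bar> ^ a \<le> fact a * (2 / lam) ^ a * exp (lam / 2 * \<bar>x\<bar>)"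
      using lam_pos by (simp add: field_simps power_mult_distrib power_divide)
    have "h x \<le> b0 * 1 + b1 * \<bar>x\<bar> ^ a"
      using h_poly by simp
    also have "\<dots> \<le> b0 * exp (lam / 2 * \<bar>x\<bar>) + b1 * (fact a * (2 / lam) ^ a * exp (lam / 2 * \<bar>x\<bar>))"
      using * b0_nonneg b1_nonneg lam_pos by (intro add_mono mult_left_mono) auto
    also have "\<dots> = (b0 + b1 * fact a * (2 / lam) ^ a) * exp (lam / 2 * \<bar>x\<bar>)"
      by (simp add: algebra_simps)
    also have "\<dots> \<le> (b0 + b1 * fact a * (2 / lam) ^ a) * exp (lam * \<bar>y\<bar> + lam / 2 * x)"
    proof (rule mult_left_mono)
      \<comment> \<open>Since \<open>y \<le> x\<close>, the bound
        \<open>\<bar>x\<bar> \<le> 2 * \<bar>y\<bar> + x\<close> holds for negative \<open>x\<close>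
        too.\<close>
      have "lam / 2 * \<bar>x\<bar> \<le> lam / 2 * (2 * \<bar>y\<bar> + x)"
        using that lam_pos by (intro mult_left_mono) auto
      then show "exp (lam / 2 * \<bar>x\<bar>) \<le> exp (lam * \<bar>y\<bar> + lam / 2 * x)"
        by (simp add: algebra_simps)
    qed (use b0_nonneg b1_nonneg lam_pos in auto)
    also have "\<dots> = C * exp (lam / 2 * x)"
      by (simp add: C_def exp_add)
    finally have "h x * exp (- lam * x) \<le> C * exp (lam / 2 * x) * exp (- lam * x)"
      by (intro mult_right_mono) auto
    also have "\<dots> = C * exp (- (lam / 2) * x)"
      by (simp add: mult.assoc flip: exp_add)
    finally show ?thesis .
  qed
  have "set_integrable lborel {y..} (\<lambda>x. C * exp (- (lam / 2) * x))"
    using set_integrable_exp_minus_atLeast[of "lam / 2" y] lam_pos by simp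
  moreover have "(\<lambda>x. h x * exp (- lam * x)) \<in> borel_measurable borel"
    by (intro borel_measurable_continuous_onI continuous_intros continuous_on_h)
  then have "set_borel_measurable lborel {y..} (\<lambda>x. h x * exp (- lam * x))"
    by (simp add: set_borel_measurable_def)
  ultimately show ?thesis
  proof (rule set_integrable_bound)
    show "AE x in lborel. x \<in> {y..} \<longrightarrow> norm (h x * exp (- lam * x)) \<le> norm (C * exp (- (lam / 2) * x))"
      using bound by (auto intro!: AE_I2 order_trans[OF _ abs_ge_self] simp: h_nonneg)
  qed
qed

section \<open>The mean of \<open>h\<close> at \<open>y\<close> plus an exponential variable of rate
  \<open>lam\<close>\<close>

definition g :: "real \<Rightarrow> real" where
  "g y = lam * (LBINT u:{0..}. h (u + y) * exp (- lam * u))"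

lemma set_integrable_shift: "set_integrable lborel {0..} (\<lambda>u. h (u + y) * exp (- lam * u))"
proof -
  have "set_integrable lborel {y..} (\<lambda>x. exp (lam * y) * (h x * exp (- lam * x)))"
    using set_integrable_h_exp by (intro set_integrable_mult_right)
  then have "integrable lborel
      (\<lambda>u. indicator {y..} (y + 1 * u) *\<^sub>R (exp (lam * y) * (h (y + 1 * u) * exp (- lam * (y + 1 * u)))))"
    unfolding set_integrable_def by (rule lborel_integrable_real_affine) simp
  also have "(\<lambda>u. indicator {y..} (y + 1 * u) *\<^sub>R (exp (lam * y) * (h (y + 1 * u) * exp (- lam * (y + 1 * u)))))
    = (\<lambda>u. indicator {0..} u *\<^sub>R (h (u + y) * exp (- lam * u)))"
    by (auto simp: fun_eq_iff indicator_def add.commute algebra_simps simp flip: exp_add)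
  finally show ?thesis
    unfolding set_integrable_def .
qed

text \<open>Substituting \<open>x = u + y\<close> moves \<open>y\<close> from the integrand to the
  limit of integration, so that \<open>g\<close> can be differentiated without differentiating
  \<open>h\<close>.\<close>

lemma g_eq: "g y = lam * exp (lam * y) * (LBINT x:{y..}. h x * exp (- lam * x))"
proof -
  have "(LBINT x:{y..}. h x * exp (- lam * x)) =
      (LBINT u. indicator {y..} (y + 1 * u) *\<^sub>R (h (y + 1 * u) * exp (- lam * (y + 1 * u))))"
    unfolding set_lebesgue_integral_def
    by (subst lborel_integral_real_affine[where c = 1 and t = y]) simp_all
  also have "\<dots> = (LBINT u. exp (- lam * y) * (indicator {0..} u *\<^sub>R (h (u + y) * exp (- lam * u))))"
    by (intro Bochner_Integration.integral_cong)
       (auto simp: indicator_def add.commute algebra_simps simp flip: exp_add)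
  also have "\<dots> = exp (- lam * y) * (LBINT u:{0..}. h (u + y) * exp (- lam * u))"
    by (simp add: set_lebesgue_integral_def)
  finally show ?thesis
    by (simp add: g_def exp_minus)
qed

lemma g_nonneg: "g y \<ge> 0"
  unfolding g_def set_lebesgue_integral_def using lam_pos
  by (intro mult_nonneg_nonneg integral_nonneg_AE) (auto simp: h_nonneg)

lemma convex_g: "convex_on UNIV g"
proof (rule convex_onI)
  fix t x y :: real
  assume t: "0 < t" "t < 1"
  let ?I = "\<lambda>y. LBINT u:{0..}. h (u + y) * exp (- lam * u)"
  have "?I ((1 - t) * x + t * y) \<le>
      (LBINT u:{0..}. (1 - t) * (h (u + x) * exp (- lam * u)) + t * (h (u + y) * exp (- lam * u)))"
  proof (rule set_integral_mono)
    fix u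
    have "h (u + ((1 - t) * x + t * y)) = h ((1 - t) * (u + x) + t * (u + y))"
      by (simp add: algebra_simps)
    also have "\<dots> \<le> (1 - t) * h (u + x) + t * h (u + y)"
      using convex_onD[OF h_convex, of t "u + x" "u + y"] t by simp
    finally have "h (u + ((1 - t) * x + t * y)) * exp (- lam * u)
       \<le> ((1 - t) * h (u + x) + t * h (u + y)) * exp (- lam * u)"
      by (rule mult_right_mono) simp
    then show "h (u + ((1 - t) * x + t * y)) * exp (- lam * u)
       \<le> (1 - t) * (h (u + x) * exp (- lam * u)) + t * (h (u + y) * exp (- lam * u))"
      by (simp add: distrib_right mult.assoc)
  next
    show "set_integrable lborel {0..} (\<lambda>u. (1 - t) * (h (u + x) * exp (- lam * u)) + t * (h (u + y) * exp (- lam * u)))"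
      by (intro set_integral_add(1) set_integrable_mult_right[OF set_integrable_shift])
  qed (rule set_integrable_shift)
  also have "\<dots> = (1 - t) * ?I x + t * ?I y"
    using set_integral_add(2)[OF set_integrable_mult_right[OF set_integrable_shift[of x], of "1 - t"]
        set_integrable_mult_right[OF set_integrable_shift[of y], of t]]
    by simp
  finally have "lam * ?I ((1 - t) * x + t * y) \<le> lam * ((1 - t) * ?I x + t * ?I y)"
    using lam_pos by (intro mult_left_mono) auto
  then show "g ((1 - t) *\<^sub>R x + t *\<^sub>R y) \<le> (1 - t) * g x + t * g y"
    by (simp add: g_def algebra_simps)
qed auto

lemma continuous_on_g: "continuous_on S g"
  using convex_on_continuous[OF open_UNIV convex_g] continuous_on_subset by blast

text \<open>By \<open>g_eq\<close> this is the product rule: the exponential factor contributes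
  \<open>lam * g y\<close>, the tail integral \<open>- lam * h y\<close>.\<close>

lemma has_derivative_g: "(g has_real_derivative lam * (g y - h y)) (at y)"
proof -
  let ?H = "\<lambda>x. h x * exp (- lam * x)"
  have cont: "continuous_on UNIV ?H"
    by (intro continuous_intros continuous_on_h)
  obtain P where P: "\<And>x. (P has_real_derivative ?H x) (at x)"
    using ex_antiderivative[OF cont] by blast
  \<comment> \<open>With a base point to the left of \<open>y\<close>, the formula for the tail
    integral holds on a whole neighbourhood of \<open>y\<close>.\<close>
  define c where "c = y - 1"
  define J where "J = (LBINT x:{c..}. ?H x)"
  have tail: "(LBINT x:{z..}. ?H x) = J - (P z - P c)" if "z > c" for z
  proof -
    have "{c..} = {c..z} \<union> {z..}"
      using that by auto
    then have "J = (LBINT x:{c..z} \<union> {z..}. ?H x)"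
      by (simp add: J_def)
    also have "\<dots> = (LBINT x:{c..z}. ?H x) + (LBINT x:{z..}. ?H x)"
    proof (rule set_integral_Un_AE)
      show "AE x in lborel. \<not> (x \<in> {c..z} \<and> x \<in> {z..})"
        using AE_lborel_singleton[of z] by eventually_elim auto
      show "set_integrable lborel {c..z} ?H"
        by (rule set_integrable_subset[OF set_integrable_h_exp[of c]]) auto
    qed (use set_integrable_h_exp in auto)
    also have "(LBINT x:{c..z}. ?H x) = P z - P c"
      using that by (intro set_lebesgue_integral_FTC P cont) auto
    finally show ?thesis by simp
  qed
  have "((\<lambda>z. lam * exp (lam * z) * (J - (P z - P c))) has_real_derivative
      lam * (lam * exp (lam * y) * (J - (P y - P c)) - exp (lam * y) * ?H y)) (at y)"
    by (auto intro!: derivative_eq_intros P simp: algebra_simps)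
  also have "lam * exp (lam * y) * (J - (P y - P c)) = g y"
    using tail[of y] by (simp add: g_eq c_def)
  also have "exp (lam * y) * ?H y = h y"
    by (simp add: exp_minus)
  finally have "((\<lambda>z. lam * exp (lam * z) * (J - (P z - P c))) has_real_derivative lam * (g y - h y)) (at y)" .
  moreover have "open {c<..}" "y \<in> {c<..}"
    by (auto simp: c_def)
  ultimately show ?thesis
    by (rule has_field_derivative_transform_within_open) (use tail in \<open>simp add: g_eq\<close>)
qed

section \<open>The sign of \<open>g - h\<close> and the growth of \<open>g\<close>\<close>

lemma g_minus_h_mono:
  assumes "x \<le> y"
  shows "g x - h x \<le> g y - h y"
  using convex_on_deriv_mono[OF convex_g assms has_derivative_g has_derivative_g] lam_pos by simp

text \<open>As \<open>g - h\<close> is nondecreasing, \<open>g 0 > 0\<close> suffices. Positivity is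
  carried back to 0 from \<open>g 1 \<ge> h 1 > 0\<close>.\<close>

lemma g_gt_h:
  assumes "y \<ge> 0"
  shows "h y < g y"
proof -
  have "h 1 \<le> g 1"
    using g_minus_h_mono[of 0 1] g_nonneg[of 0] h_zero by simp
  then have "0 < exp (- lam * 1) * g 1"
    using h_pos[of 1] by simp
  \<comment> \<open>The factor \<open>exp (- lam * x)\<close> cancels the \<open>g\<close> term of
    the derivative and leaves a nonpositive multiple of \<open>h\<close>.\<close>
  also have "exp (- lam * 1) * g 1 \<le> exp (- lam * 0) * g 0"
  proof (rule DERIV_nonpos_imp_nonincreasing[where f = "\<lambda>x. exp (- lam * x) * g x"])
    fix x
    have "((\<lambda>x. exp (- lam * x) * g x) has_real_derivative - lam * exp (- lam * x) * h x) (at x)"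
      by (auto intro!: derivative_eq_intros has_derivative_g simp: algebra_simps)
    moreover have "- lam * exp (- lam * x) * h x \<le> 0"
      using lam_pos h_nonneg by simp
    ultimately show "\<exists>d. ((\<lambda>x. exp (- lam * x) * g x) has_real_derivative d) (at x) \<and> d \<le> 0"
      by blast
  qed simp
  finally have "0 < g 0"
    by simp
  with g_minus_h_mono[OF assms] show ?thesis
    by (simp add: h_zero)
qed

lemma g_eq_h_unique:
  assumes "g x = h x" "g y = h y"
  shows "x = y"
proof -
  have False if "x < y" "g x = h x" "g y = h y" for x y
  proof -
    \<comment> \<open>Both points now lie where \<open>h\<close> is strictly decreasing, so
      \<open>h x = h y\<close> is impossible.\<close>
    have "y < 0"
      using g_gt_h[of y] that by force
    have "g x = g y"
    proof (rule DERIV_isconst2[of x y g, THEN sym])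
      fix t assume "x < t" "t < y"
      then have "g t = h t"
        using g_minus_h_mono[of x t] g_minus_h_mono[of t y] that by simp
      then show "(g has_real_derivative 0) (at t)"
        using has_derivative_g[of t] by simp
    qed (use that continuous_on_g in auto)
    with that h_strict_decreasing[of x y] \<open>y < 0\<close> show False
      by simp
  qed
  with assms show ?thesis
    by (metis linorder_neqE)
qed

text \<open>Otherwise \<open>g\<close> would be nondecreasing up to 0, and
  \<open>h \<le> g \<le> g 0\<close> would bound \<open>h\<close> on the negative axis.\<close>

lemma ex_g_less_h: "\<exists>x<0. g x < h x"
proof (rule ccontr)
  assume "\<not> ?thesis"
  then have le: "h x \<le> g x" if "x < 0" for x
    using that by force
  obtain x where x: "x < 0" "g 0 < h x"
    using h_unbounded by blast
  have "g x \<le> g 0"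
  proof (rule DERIV_nonneg_imp_nondecreasing[where f = g])
    fix t assume "x \<le> t" "t \<le> 0"
    then have "0 \<le> lam * (g t - h t)"
      using le[of t] g_gt_h[of t] lam_pos by (cases "t = 0") auto
    then show "\<exists>d. (g has_real_derivative d) (at t) \<and> 0 \<le> d"
      using has_derivative_g by blast
  qed (use x in simp)
  with x le[of x] show False
    by simp
qed

lemma ex_g_eq_h: "\<exists>z<0. g z = h z"
proof -
  obtain x where x: "x < 0" "g x < h x"
    using ex_g_less_h by blast
  have "\<exists>z. x \<le> z \<and> z \<le> 0 \<and> g z - h z = 0"
    by (rule IVT') (use x g_gt_h[of 0] in \<open>auto intro!: continuous_intros continuous_on_g continuous_on_h\<close>)
  then show ?thesis
    using g_gt_h[of 0] by (metis eq_iff_diff_eq_0 less_irrefl order_less_le)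
qed

lemma g_less_h:
  assumes "g z = h z" "y < z"
  shows "g y < h y"
  using g_minus_h_mono[of y z] g_eq_h_unique[of y z] assms by fastforce

lemma g_greater_h:
  assumes "g z = h z" "z < y"
  shows "h y < g y"
  using g_minus_h_mono[of z y] g_eq_h_unique[of y z] assms by fastforce

lemma g_strict_decreasing:
  assumes "g z = h z" "x < y" "y \<le> z"
  shows "g y < g x"
proof (rule DERIV_neg_imp_decreasing_open[where f = g])
  fix t assume "x < t" "t < y"
  then show "\<exists>d. (g has_real_derivative d) (at t) \<and> d < 0"
    using has_derivative_g[of t] g_less_h[OF assms(1), of t] assms lam_pos
    by (intro exI[of _ "lam * (g t - h t)"]) (auto simp: mult_less_0_iff)
qed (use assms continuous_on_g in auto)

lemma g_strict_increasing:
  assumes "g z = h z" "x < y" "z \<le> x"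
  shows "g x < g y"
proof (rule DERIV_pos_imp_increasing_open[where f = g])
  fix t assume "x < t" "t < y"
  then show "\<exists>d. (g has_real_derivative d) (at t) \<and> d > 0"
    using has_derivative_g[of t] g_greater_h[OF assms(1), of t] assms lam_pos
    by (intro exI[of _ "lam * (g t - h t)"]) auto
qed (use assms continuous_on_g in auto)

text \<open>Two tangents of the convex \<open>g\<close> bound it from below: one of positive slope
  at 0, one of negative slope at a point where \<open>g < h\<close>.\<close>

lemma g_ge_linear: "\<exists>\<alpha>>0. \<exists>\<beta>. \<forall>y. \<alpha> * \<bar>y\<bar> - \<beta> \<le> g y"
proof -
  have tangent: "g c + lam * (g c - h c) * (y - c) \<le> g y" for c y
    using convex_on_imp_above_tangent[OF convex_g, of c y "lam * (g c - h c)"] has_derivative_g[of c]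
    by simp
  obtain x where x: "x < 0" "g x < h x"
    using ex_g_less_h by blast
  define p where "p = lam * (g 0 - h 0)"
  define q where "q = lam * (h x - g x)"
  have pq: "p > 0" "q > 0"
    using x g_gt_h[of 0] lam_pos by (auto simp: p_def q_def)
  define \<alpha> where "\<alpha> = min p q"
  have "\<alpha> * \<bar>y\<bar> - q * \<bar>x\<bar> \<le> g y" for y
  proof (cases "y \<ge> 0")
    case True
    then have "\<alpha> * \<bar>y\<bar> \<le> p * y"
      by (auto simp: \<alpha>_def intro: mult_right_mono)
    also have "\<dots> \<le> g y"
      using tangent[of 0 y] g_nonneg[of 0] by (simp add: p_def)
    finally show ?thesis
      using pq by (smt (verit) mult_nonneg_nonneg)
  next
    case False
    then have "\<alpha> * \<bar>y\<bar> \<le> q * (- y)"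
      by (auto simp: \<alpha>_def intro: mult_right_mono)
    also have "\<dots> - q * \<bar>x\<bar> \<le> g y"
      using tangent[of x y] g_nonneg[of x] x by (simp add: q_def algebra_simps)
    finally show ?thesis
      by simp
  qed
  moreover have "\<alpha> > 0"
    using pq by (simp add: \<alpha>_def)
  ultimately show ?thesis by blast
qed

section \<open>Averages of \<open>g\<close> over intervals, through an antiderivative\<close>

definition G :: "real \<Rightarrow> real" where
  "G = (SOME F. \<forall>x. (F has_real_derivative g x) (at x))"

lemma has_derivative_G: "(G has_real_derivative g x) (at x)"
  using someI_ex[OF ex_antiderivative[OF continuous_on_g]] unfolding G_def by blast

lemma integral_g: "s \<le> S \<Longrightarrow> (LBINT y:{s..S}. g y) = G S - G s"
  by (intro set_lebesgue_integral_FTC has_derivative_G continuous_on_g)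

text \<open>Lets the average over a short interval be compared with \<open>g\<close> at a nearby
  point when semicontinuity is proved on the diagonal.\<close>

lemma average_eq_value:
  assumes "s < S"
  shows "\<exists>y>s. y < S \<and> (G S - G s) / (S - s) = g y"
  using MVT2[OF assms has_derivative_G] assms by (force simp: field_simps)

text \<open>A bounded average bounds both the midpoint \<open>m\<close> and the length
  \<open>L\<close>: the linear lower bound of \<open>g\<close> integrates to a quadratic one,
  applied over the whole interval for \<open>m\<close> and over its two halves for
  \<open>L\<close>.\<close>

lemma average_coercive:
  "\<exists>R. \<forall>s S. s < S \<longrightarrow> (G S - G s) / (S - s) \<le> C \<longrightarrow> \<bar>s\<bar> \<le> R \<and> \<bar>S\<bar> \<le> R"
proof -
  obtain \<alpha> \<beta> where \<alpha>: "\<alpha> > 0" and le: "\<And>y. \<alpha> * \<bar>y\<bar> - \<beta> \<le> g y"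
    using g_ge_linear by blast
  \<comment> \<open>integrating the linear lower bounds of slope \<open>\<alpha>\<close> and \<open>- \<alpha>\<close>\<close>
  have quad: "c / 2 * (y\<^sup>2 - x\<^sup>2) - \<beta> * (y - x) \<le> G y - G x" if "x \<le> y" "\<bar>c\<bar> = \<alpha>" for c x y
  proof -
    have "G x - c / 2 * x\<^sup>2 + \<beta> * x \<le> G y - c / 2 * y\<^sup>2 + \<beta> * y"
    proof (rule DERIV_nonneg_imp_nondecreasing[OF \<open>x \<le> y\<close>])
      fix t
      have "((\<lambda>t. G t - c / 2 * t\<^sup>2 + \<beta> * t) has_real_derivative g t - c * t + \<beta>) (at t)"
        by (auto intro!: derivative_eq_intros has_derivative_G)
      moreover have "c * t \<le> \<alpha> * \<bar>t\<bar>"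
        using that(2) by (metis abs_ge_self abs_mult)
      then have "0 \<le> g t - c * t + \<beta>"
        using le[of t] by simp
      ultimately show "\<exists>d. ((\<lambda>t. G t - c / 2 * t\<^sup>2 + \<beta> * t) has_real_derivative d) (at t) \<and> 0 \<le> d"
        by blast
    qed
    then show ?thesis
      by (simp add: algebra_simps)
  qed
  define B where "B = (C + \<beta>) / \<alpha>"
  \<comment> \<open>The constant \<open>3 * B\<close> is the sum of the bounds
    \<open>\<bar>m\<bar> \<le> B\<close> and \<open>L / 2 \<le> 2 * B\<close>.\<close>
  have "\<bar>s\<bar> \<le> 3 * B \<and> \<bar>S\<bar> \<le> 3 * B" if "s < S" and C: "(G S - G s) / (S - s) \<le> C" for s S
  proof -
    define m where "m = (s + S) / 2"
    define L where "L = S - s"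
    have sS: "s = m - L / 2" "S = m + L / 2" and "L > 0"
      using \<open>s < S\<close> by (auto simp: m_def L_def field_simps)
    have C': "G S - G s \<le> C * L"
      using C \<open>s < S\<close> by (simp add: L_def field_simps)
    have "c * m \<le> C + \<beta>" if "\<bar>c\<bar> = \<alpha>" for c
    proof -
      have "c / 2 * (S\<^sup>2 - s\<^sup>2) - \<beta> * (S - s) \<le> C * L"
        using quad[of s S c] that \<open>s < S\<close> C' by simp
      then have "(c * m) * L \<le> (C + \<beta>) * L"
        unfolding sS by (simp add: power2_eq_square field_simps)
      then show ?thesis
        using \<open>L > 0\<close> by simp
    qed
    from this[of \<alpha>] this[of "- \<alpha>"] \<alpha> have "\<bar>m\<bar> \<le> B"
      by (auto simp: B_def abs_le_iff field_simps)
    moreover have "L / 4 \<le> B"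
    proof -
      \<comment> \<open>slope \<open>- \<alpha>\<close> on the left half and slope \<open>\<alpha>\<close> on the right half\<close>
      have "- \<alpha> / 2 * (m\<^sup>2 - s\<^sup>2) - \<beta> * (m - s) \<le> G m - G s"
        "\<alpha> / 2 * (S\<^sup>2 - m\<^sup>2) - \<beta> * (S - m) \<le> G S - G m"
        using quad[of s m "- \<alpha>"] quad[of m S \<alpha>] \<open>L > 0\<close> \<alpha> by (auto simp: sS)
      with C' have "- \<alpha> / 2 * (m\<^sup>2 - s\<^sup>2) - \<beta> * (m - s) + (\<alpha> / 2 * (S\<^sup>2 - m\<^sup>2) - \<beta> * (S - m)) \<le> C * L"
        by simp
      then have "(\<alpha> * L / 4) * L \<le> (C + \<beta>) * L"
        unfolding sS by (simp add: power2_eq_square field_simps)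
      then have "\<alpha> * L / 4 \<le> C + \<beta>"
        using \<open>L > 0\<close> by (rule mult_right_le_imp_le)
      then show ?thesis
        using \<alpha> by (simp add: B_def field_simps)
    qed
    ultimately show ?thesis
      unfolding sS abs_le_iff using \<open>L > 0\<close> by linarith
  qed
  then show ?thesis by blast
qed

lemma average_shift_minimal:
  assumes "s < S"
    and min: "\<And>t. (G S - G s) / (S - s) \<le> (G (S + t) - G (s + t)) / (S - s)"
  shows "g s = g S"
proof -
  have "((\<lambda>t. G (S + t) - G (s + t)) has_real_derivative g S - g s) (at 0)"
    using has_derivative_G[of "S + 0"] has_derivative_G[of "s + 0"]
    by (auto intro!: derivative_eq_intros DERIV_chain'[where f = "\<lambda>t. _ + t" and g = G])
  moreover have "\<forall>t. \<bar>0 - t\<bar> < 1 \<longrightarrow> G (S + 0) - G (s + 0) \<le> G (S + t) - G (s + t)"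
    using min \<open>s < S\<close> by (simp add: divide_le_cancel)
  ultimately have "g S - g s = 0"
    by (intro DERIV_local_min[where d = 1]) auto
  then show ?thesis by simp
qed

end

subsection \<open>The long-run cost as a function of the interval\<close>

locale cost_rate = running_cost +
  fixes K :: "real \<Rightarrow> real" and k \<mu> :: real
  assumes K_nonneg: "\<xi> \<ge> 0 \<Longrightarrow> K \<xi> \<ge> 0"
    and K_lsc: "x > 0 \<Longrightarrow> ereal (K x) \<le> Liminf (at x) (\<lambda>\<xi>. ereal (K \<xi>))"
    and mu_pos: "\<mu> > 0" and k_nonneg: "k \<ge> 0"
begin

abbreviation "\<gamma> \<equiv> gamma_cost K h k \<mu> lam"

section \<open>Coercivity and lower semicontinuity of the cost\<close>

lemma ell_nonneg: "0 \<le> ell K"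
  unfolding ell_def
  by (rule Liminf_bounded) (auto simp: eventually_at_filter K_nonneg)

lemma gamma_less:
  assumes "s < S"
  shows "\<gamma> s S = ereal (k * \<mu> + K (S - s) * \<mu> / (S - s) + (G S - G s) / (S - s))"
  using assms integral_g[of s S] lam_pos
  by (simp add: gamma_cost_def g_def[abs_def])

lemma gamma_diag: "\<gamma> s s = (ereal k + ell K) * ereal \<mu> + ereal (g s)"
  by (simp add: gamma_cost_def g_def)

lemma gamma_diag_infinity:
  assumes "ell K = \<infinity>"
  shows "\<gamma> s s = \<infinity>"
  using assms mu_pos by (simp add: gamma_diag)

lemma gamma_diag_real:
  assumes "ell K = ereal e"
  shows "\<gamma> s s = ereal ((k + e) * \<mu> + g s)"
  using assms by (simp add: gamma_diag)

text \<open>All terms other than the average of \<open>g\<close>, or \<open>g s\<close> on the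
  diagonal, are nonnegative, so the growth of these two confines the interval.\<close>

lemma gamma_coercive: "\<exists>R. \<forall>s S. s \<le> S \<longrightarrow> \<gamma> s S \<le> ereal C \<longrightarrow> \<bar>s\<bar> \<le> R \<and> \<bar>S\<bar> \<le> R"
proof -
  obtain R where R: "\<And>s S. s < S \<Longrightarrow> (G S - G s) / (S - s) \<le> C \<Longrightarrow> \<bar>s\<bar> \<le> R \<and> \<bar>S\<bar> \<le> R"
    using average_coercive by blast
  obtain \<alpha> \<beta> where \<alpha>: "\<alpha> > 0" and le: "\<And>y. \<alpha> * \<bar>y\<bar> - \<beta> \<le> g y"
    using g_ge_linear by blast
  have "\<bar>s\<bar> \<le> max R ((C + \<beta>) / \<alpha>) \<and> \<bar>S\<bar> \<le> max R ((C + \<beta>) / \<alpha>)"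
    if "s \<le> S" "\<gamma> s S \<le> ereal C" for s S
  proof (cases "s < S")
    case True
    have "0 \<le> k * \<mu>" "0 \<le> K (S - s) * \<mu> / (S - s)"
      using True k_nonneg mu_pos K_nonneg[of "S - s"] by auto
    with that True have "(G S - G s) / (S - s) \<le> C"
      by (simp add: gamma_less)
    from R[OF True this] show ?thesis
      by (simp add: le_max_iff_disj)
  next
    case False
    with that have [simp]: "S = s" by simp
    have "0 \<le> (ereal k + ell K) * ereal \<mu>"
      using ell_nonneg k_nonneg mu_pos by (intro ereal_0_le_mult add_nonneg_nonneg) auto
    then have "ereal (g s) \<le> \<gamma> s S"
      using add_mono[of 0 "(ereal k + ell K) * ereal \<mu>" "ereal (g s)" "ereal (g s)"]
      by (simp add: gamma_diag)
    with that have "ereal (g s) \<le> ereal C"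
      by (metis order_trans)
    with le[of s] have "\<alpha> * \<bar>s\<bar> \<le> C + \<beta>"
      by simp
    then have "\<bar>s\<bar> \<le> (C + \<beta>) / \<alpha>"
      using \<alpha> by (simp add: field_simps)
    then show ?thesis
      by (simp add: le_max_iff_disj)
  qed
  then show ?thesis by blast
qed

text \<open>\<open>K\<close> need not be continuous. Replacing its value by a slightly smaller
  constant \<open>\<kappa>\<close> gives a continuous function \<open>\<Phi> \<kappa>\<close> that
  still exceeds \<open>c\<close> near \<open>(s, S)\<close> and lies below the cost there.\<close>

lemma gamma_lsc_offdiag:
  assumes "s < S" "ereal c < \<gamma> s S"
  shows "\<forall>\<^sub>F q in nhds (s, S). ereal c < \<gamma> (fst q) (snd q)"
proof -
  define \<Phi> where "\<Phi> \<kappa> q = k * \<mu> + \<kappa> * \<mu> / (snd q - fst q) + (G (snd q) - G (fst q)) / (snd q - fst q)"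
    for \<kappa> and q :: "real \<times> real"
  have "((\<lambda>\<kappa>. \<Phi> \<kappa> (s, S)) \<longlongrightarrow> \<Phi> (K (S - s)) (s, S)) (at_left (K (S - s)))"
    unfolding \<Phi>_def using assms(1) by (auto intro!: tendsto_intros)
  moreover have "c < \<Phi> (K (S - s)) (s, S)"
    using assms by (simp add: \<Phi>_def gamma_less)
  ultimately have "\<forall>\<^sub>F \<kappa> in at_left (K (S - s)). c < \<Phi> \<kappa> (s, S)"
    by (rule order_tendstoD)
  then have "\<forall>\<^sub>F \<kappa> in at_left (K (S - s)). c < \<Phi> \<kappa> (s, S) \<and> \<kappa> < K (S - s)"
    by (rule eventually_conj) (simp add: eventually_at_filter)
  then obtain \<kappa> where \<kappa>: "c < \<Phi> \<kappa> (s, S)" "\<kappa> < K (S - s)"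
    using eventually_happens trivial_limit_at_left_real by blast
  have contG: "isCont G x" for x
    using has_derivative_G DERIV_isCont by blast
  have "continuous (at (s, S)) (\<Phi> \<kappa>)"
    unfolding \<Phi>_def using assms(1)
    by (intro continuous_intros continuous_within_compose3[OF contG] isCont_o2[OF _ contG]) auto
  then have "(\<Phi> \<kappa> \<longlongrightarrow> \<Phi> \<kappa> (s, S)) (nhds (s, S))"
    by (simp add: continuous_within tendsto_at_iff_tendsto_nhds)
  then have ev\<Phi>: "\<forall>\<^sub>F q in nhds (s, S). c < \<Phi> \<kappa> q"
    using \<kappa>(1) by (rule order_tendstoD)
  have diff: "((\<lambda>q. snd q - fst q) \<longlongrightarrow> S - s) (nhds (s, S))"
    using tendsto_diff[OF tendsto_snd[OF filterlim_ident] tendsto_fst[OF filterlim_ident], of "(s, S)"]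
    by simp
  have "ereal \<kappa> < Liminf (at (S - s)) (\<lambda>\<xi>. ereal (K \<xi>))"
    using K_lsc[of "S - s"] assms(1) \<kappa>(2) by (intro less_le_trans[OF _ K_lsc]) auto
  \<comment> \<open>The lower limit ignores the point \<open>S - s\<close> itself, where
    \<open>\<kappa> < K (S - s)\<close> is known.\<close>
  from less_LiminfD[OF this] have "\<forall>\<^sub>F \<xi> in nhds (S - s). \<kappa> < K \<xi>"
    using \<kappa>(2) by (simp add: eventually_at_filter) (erule eventually_mono; auto)
  with diff have evK: "\<forall>\<^sub>F q in nhds (s, S). \<kappa> < K (snd q - fst q)"
    by (rule eventually_compose_filterlim[rotated])
  have "\<forall>\<^sub>F q in nhds (s, S). 0 < snd q - fst q"
    using order_tendstoD(1)[OF diff, of 0] assms(1) by simp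
  with ev\<Phi> evK show ?thesis
  proof eventually_elim
    case (elim q)
    then have "\<kappa> * \<mu> / (snd q - fst q) \<le> K (snd q - fst q) * \<mu> / (snd q - fst q)"
      using mu_pos by (intro divide_right_mono mult_right_mono) auto
    with elim show ?case
      by (simp add: \<Phi>_def gamma_less)
  qed
qed

text \<open>Nearby costs come from short intervals or from diagonal points. A real \<open>e\<close>
  below \<open>ell K\<close> bounds the contribution of \<open>K\<close> in both cases, and
  continuity of \<open>g\<close> at \<open>s\<close> keeps the rest above \<open>v\<close>.\<close>

lemma gamma_lsc_diag:
  assumes "ereal c < \<gamma> s s"
  shows "\<forall>\<^sub>F q in nhds (s, s). fst q \<le> snd q \<longrightarrow> ereal c < \<gamma> (fst q) (snd q)"
proof -
  \<comment> \<open>The hypothesis solved for \<open>ell K\<close>. It also holds when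
    \<open>ell K\<close> is infinite, so a real \<open>e\<close> in between always exists.\<close>
  have "ereal ((c - g s) / \<mu> - k) < ell K"
  proof (cases "ell K")
    case (real e)
    with assms mu_pos show ?thesis
      by (simp add: gamma_diag_real field_simps)
  qed (use ell_nonneg in auto)
  then obtain e where e: "(c - g s) / \<mu> - k < e" "ereal e < ell K"
    using ereal_dense2 by (metis less_ereal.simps(1))
  define v where "v = c - (k + e) * \<mu>"
  have "v < g s"
    using e(1) mu_pos by (simp add: v_def field_simps)
  have "(g \<longlongrightarrow> g s) (nhds s)"
    using continuous_on_g[of UNIV] by (simp add: continuous_on_eq_continuous_at continuous_within tendsto_at_iff_tendsto_nhds)
  then have "\<forall>\<^sub>F y in nhds s. v < g y"
    using \<open>v < g s\<close> by (rule order_tendstoD)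
  then obtain d where d: "d > 0" "\<And>y. dist y s < d \<Longrightarrow> v < g y"
    by (auto simp: eventually_nhds_metric)
  have "\<forall>\<^sub>F \<xi> in at_right 0. ereal e < ereal (K \<xi> / \<xi>)"
    using e(2) unfolding ell_def by (rule less_LiminfD)
  then obtain b where b: "b > 0" "\<And>\<xi>. 0 < \<xi> \<Longrightarrow> \<xi> < b \<Longrightarrow> e < K \<xi> / \<xi>"
    by (auto simp: eventually_at_right_field)
  have lims: "(fst \<longlongrightarrow> s) (nhds (s, s))" "(snd \<longlongrightarrow> s) (nhds (s, s))"
    using tendsto_fst[OF filterlim_ident[of "nhds (s, s)"]] tendsto_snd[OF filterlim_ident[of "nhds (s, s)"]]
    by simp_all
  have "\<forall>\<^sub>F q in nhds (s, s). dist (fst q) s < d"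
    "\<forall>\<^sub>F q in nhds (s, s). dist (snd q) s < d"
    "\<forall>\<^sub>F q in nhds (s, s). snd q - fst q < b"
    using lims d(1) tendstoD order_tendstoD(2)[OF tendsto_diff[OF lims(2,1)], of b] b(1) by auto
  then show ?thesis
  proof eventually_elim
    case (elim q)
    obtain s' S' where q: "q = (s', S')"
      by (cases q)
    show ?case
    proof
      assume "fst q \<le> snd q"
      then consider "s' < S'" | "s' = S'"
        using q by fastforce
      then show "ereal c < \<gamma> (fst q) (snd q)"
      proof cases
        case 1
        from average_eq_value[OF this] obtain y where
          y: "s' < y" "y < S'" "(G S' - G s') / (S' - s') = g y"
          by blast
        have "v < g y"
          using elim q y by (intro d(2)) (auto simp: dist_real_def)
        moreover have "e * \<mu> < K (S' - s') / (S' - s') * \<mu>"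
          using 1 elim q b(2)[of "S' - s'"] mu_pos by (intro mult_strict_right_mono) auto
        ultimately show ?thesis
          using 1 y(3) by (simp add: q gamma_less v_def algebra_simps)
      next
        case 2
        have "v < g s'"
          using elim q by (intro d(2)) auto
        then have "ereal c < ereal ((k + e) * \<mu> + g s')"
          by (simp add: v_def)
        also have "\<dots> = (ereal k + ereal e) * ereal \<mu> + ereal (g s')"
          by simp
        also have "\<dots> \<le> \<gamma> s' s'"
          unfolding gamma_diag using e(2) mu_pos
          by (intro add_mono ereal_mult_right_mono) auto
        finally show ?thesis
          using 2 q by simp
      qed
    qed
  qed
qed

section \<open>Existence and location of minimizers\<close>

lemma gamma_minimizer_iff:
  "gamma_minimizer \<gamma> s S \<longleftrightarrow> s \<le> S \<and> (\<forall>s' S'. s' \<le> S' \<longrightarrow> \<gamma> s S \<le> \<gamma> s' S')"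
  (is "_ \<longleftrightarrow> ?R")
proof
  assume "gamma_minimizer \<gamma> s S"
  then show ?R
    unfolding gamma_minimizer_def by (auto intro!: Inf_lower)
next
  assume ?R
  then have "\<gamma> s S = Inf {\<gamma> s' S' | s' S'. s' \<le> S'}"
    by (intro antisym Inf_greatest Inf_lower) auto
  with \<open>?R\<close> show "gamma_minimizer \<gamma> s S"
    unfolding gamma_minimizer_def by blast
qed

text \<open>Costs not exceeding \<open>\<gamma> 0 1\<close> occur only in the compact set
  \<open>T\<close>. As \<open>(0, 1)\<close> belongs to \<open>T\<close>, the minimum over
  \<open>T\<close> is global.\<close>

lemma ex_gamma_minimizer: "\<exists>s S. gamma_minimizer \<gamma> s S"
proof -
  obtain C where C: "\<gamma> 0 1 = ereal C"
    using gamma_less[of 0 1] by auto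
  obtain R where R: "\<And>s S. s \<le> S \<Longrightarrow> \<gamma> s S \<le> ereal C \<Longrightarrow> \<bar>s\<bar> \<le> R \<and> \<bar>S\<bar> \<le> R"
    using gamma_coercive by blast
  define T where "T = ({-R..R} \<times> {-R..R}) \<inter> {q. fst q \<le> snd q}"
  have "compact T"
    unfolding T_def
    by (intro compact_Int_closed compact_Times compact_Icc closed_Collect_le continuous_intros)
  have in_T: "(s, S) \<in> T" if "s \<le> S" "\<gamma> s S \<le> ereal C" for s S
    using R[OF that] that by (auto simp: T_def)
  have 01: "(0, 1) \<in> T"
    using in_T[of 0 1] C by simp
  have "\<exists>p\<in>T. \<forall>q\<in>T. \<gamma> (fst p) (snd p) \<le> \<gamma> (fst q) (snd q)"
  proof (rule compact_lower_semicontinuous_attains_min[OF \<open>compact T\<close>])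
    show "T \<noteq> {}"
      using 01 by blast
    fix p :: "real \<times> real" and c
    assume "p \<in> T" "c < \<gamma> (fst p) (snd p)"
    \<comment> \<open>The semicontinuity lemmas take real thresholds, while \<open>c\<close> is an
      extended real.\<close>
    then obtain r where r: "c < ereal r" "ereal r < \<gamma> (fst p) (snd p)"
      using ereal_dense2 by blast
    have "\<forall>\<^sub>F q in nhds p. fst q \<le> snd q \<longrightarrow> ereal r < \<gamma> (fst q) (snd q)"
    proof (cases "fst p < snd p")
      case True
      from gamma_lsc_offdiag[OF this r(2)] show ?thesis
        by (simp add: eventually_mono)
    next
      case False
      with \<open>p \<in> T\<close> have "snd p = fst p"
        by (auto simp: T_def)
      with gamma_lsc_diag[of r "fst p"] r(2) show ?thesis
        by (metis prod.collapse)
    qed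
    then obtain U where "open U" "p \<in> U" "\<And>q. q \<in> U \<Longrightarrow> fst q \<le> snd q \<Longrightarrow> ereal r < \<gamma> (fst q) (snd q)"
      by (auto simp: eventually_nhds)
    then show "\<exists>U. open U \<and> p \<in> U \<and> (\<forall>q\<in>U \<inter> T. c < \<gamma> (fst q) (snd q))"
      using r(1) by (intro exI[of _ U]) (auto simp: T_def intro: less_trans)
  qed
  then obtain s S where sS: "(s, S) \<in> T" "\<And>s' S'. (s', S') \<in> T \<Longrightarrow> \<gamma> s S \<le> \<gamma> s' S'"
    by force
  have "\<gamma> s S \<le> \<gamma> s' S'" if "s' \<le> S'" for s' S'
  proof (cases "\<gamma> s' S' \<le> ereal C")
    case True
    then show ?thesis
      using sS in_T that by blast
  next
    case False
    then have "ereal C \<le> \<gamma> s' S'"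
      by simp
    with sS(2)[OF 01] C show ?thesis
      by simp
  qed
  with sS(1) show ?thesis
    by (auto simp: gamma_minimizer_iff T_def)
qed

text \<open>The diagonal alternative records that \<open>ell K\<close> is not infinite; this
  excludes it when \<open>K0 > 0\<close>.\<close>

lemma gamma_minimizer_location:
  assumes z: "g z = h z" and min: "gamma_minimizer \<gamma> s S"
  shows "s < z \<and> z < S \<or> s = z \<and> S = z \<and> ell K \<noteq> \<infinity>"
proof -
  have le: "\<gamma> s S \<le> \<gamma> s' S'" if "s' \<le> S'" for s' S'
    using min that by (simp add: gamma_minimizer_iff)
  consider "s < S" | "s = S"
    using min by (auto simp: gamma_minimizer_iff le_less)
  then show ?thesis
  proof cases
    case 1
    have "(G S - G s) / (S - s) \<le> (G (S + t) - G (s + t)) / (S - s)" for t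
      using le[of "s + t" "S + t"] 1 by (simp add: gamma_less)
    with 1 have "g s = g S"
      by (rule average_shift_minimal)
    \<comment> \<open>Equal values at the two ends are impossible for an interval on one side of
      \<open>z\<close>, where \<open>g\<close> is strictly monotone.\<close>
    then show ?thesis
      using g_strict_decreasing[OF z 1] g_strict_increasing[OF z 1] by force
  next
    case 2
    \<comment> \<open>The minimum is at most the real number \<open>\<gamma> 0 1\<close>.\<close>
    have "\<gamma> s s \<noteq> \<infinity>"
      using le[of 0 1] gamma_less[of 0 1] 2 by auto
    then obtain e where e: "ell K = ereal e"
      using gamma_diag_infinity ell_nonneg by (cases "ell K") auto
    have "g s \<le> g z"
      using le[of z z] 2 by (simp add: gamma_diag_real[OF e])
    then have "s = z"
      using g_strict_decreasing[OF z, of s z] g_strict_increasing[OF z, of z s] by force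
    with 2 e show ?thesis by simp
  qed
qed

end

text \<open>This keeps minimizers off the diagonal when \<open>K\<close> jumps at 0.\<close>

lemma ell_infinity:
  assumes "(K \<longlongrightarrow> K0) (at_right 0)" "K0 > 0"
  shows "ell K = \<infinity>"
proof -
  have "LIM \<xi> at_right 0. K \<xi> / \<xi> :> at_top"
    using assms by (rule LIM_at_top_divide) (auto simp: eventually_at_filter)
  then have "((\<lambda>\<xi>. ereal (K \<xi> / \<xi>)) \<longlongrightarrow> \<infinity>) (at_right 0)"
    by (simp add: tendsto_PInfty_eq_at_top)
  then show ?thesis
    unfolding ell_def by (intro lim_imp_Liminf) auto
qed

text \<open>Convexity makes \<open>h\<close> continuous at 0, so the strict monotonicity that the
  derivative gives on either side extends to the value \<open>h 0 = 0\<close>.\<close>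

lemma positive_off_zero:
  fixes h :: "real \<Rightarrow> real"
  assumes "convex_on UNIV h" "h 0 = 0" "h C1_differentiable_on (- {0})"
    and "\<And>z. z > 0 \<Longrightarrow> deriv h z > 0" "\<And>z. z < 0 \<Longrightarrow> deriv h z < 0"
    and "x \<noteq> 0"
  shows "h x > 0"
proof -
  have cont: "continuous_on A h" for A
    using convex_on_continuous[OF open_UNIV assms(1)] continuous_on_subset by blast
  have deriv: "(h has_real_derivative deriv h y) (at y)" if "y \<noteq> 0" for y
    using assms(3) that
    by (auto simp: C1_differentiable_on_eq DERIV_deriv_iff_real_differentiable)
  show ?thesis
  proof (cases "x > 0")
    case True
    have "h 0 < h x"
    proof (rule DERIV_pos_imp_increasing_open[OF True, of h])
      show "\<exists>d. (h has_real_derivative d) (at t) \<and> d > 0" if "0 < t" for t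
        using deriv[of t] assms(4) that by auto
    qed (rule cont)
    then show ?thesis by (simp add: assms)
  next
    case False
    then have "x < 0" using assms by simp
    have "h 0 < h x"
    proof (rule DERIV_neg_imp_decreasing_open[OF \<open>x < 0\<close>, of h])
      show "\<exists>d. (h has_real_derivative d) (at t) \<and> d < 0" if "t < 0" for t
        using deriv[of t] assms(5) that by auto
    qed (rule cont)
    then show ?thesis by (simp add: assms)
  qed
qed

theorem proposition1:
  fixes K h :: "real \<Rightarrow> real"
    and K0 k \<mu> \<sigma> lam :: real
    and a :: nat
    and b0 b1 :: real
    and \<gamma> :: "real \<Rightarrow> real \<Rightarrow> ereal"
  assumes K_nonneg: "\<And>\<xi>. \<xi> \<ge> 0 \<Longrightarrow> K \<xi> \<ge> 0"
    and K_zero: "K 0 = 0"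
    and K_bounded: "bounded (K ` {0..})"
    and K_right_limit: "(K \<longlongrightarrow> K0) (at_right 0)"
    and K_right_deriv: "K0 = 0 \<Longrightarrow> \<exists>D. (K has_real_derivative D) (at_right 0)"
    and K_lsc: "\<And>x. x > 0 \<Longrightarrow> ereal (K x) \<le> Liminf (at x) (\<lambda>\<xi>. ereal (K \<xi>))"
    and h_convex: "convex_on UNIV h"
    and h_zero: "h 0 = 0"
    and h_C1: "h C1_differentiable_on (- {0})"
    and h_deriv_pos: "\<And>z. z > 0 \<Longrightarrow> deriv h z > 0"
    and h_deriv_neg: "\<And>z. z < 0 \<Longrightarrow> deriv h z < 0"
    and a_pos: "a > 0" and b0_pos: "b0 > 0" and b1_pos: "b1 > 0"
    and h_poly: "\<And>z. h z \<le> b0 + b1 * \<bar>z\<bar> ^ a"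
    and mu_pos: "\<mu> > 0" and sigma_pos: "\<sigma> > 0" and k_nonneg: "k \<ge> 0"
    and lam_def: "lam = 2 * \<mu> / \<sigma>\<^sup>2"
    and gamma_def: "\<gamma> = gamma_cost K h k \<mu> lam"
  shows "(\<exists>s S. gamma_minimizer \<gamma> s S) \<and>
    (\<exists>!z. lam * (LBINT u:{0..}. h (u + z) * exp (- lam * u)) = h z) \<and>
    (\<forall>z. lam * (LBINT u:{0..}. h (u + z) * exp (- lam * u)) = h z \<longrightarrow>
      z < 0 \<and>
      (\<forall>s S. gamma_minimizer \<gamma> s S \<longrightarrow>
        (K0 > 0 \<longrightarrow> s < z \<and> z < S) \<and>
        (K0 = 0 \<longrightarrow> (s < z \<and> z < S) \<or> (s = z \<and> z = S))))"
proof -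
  interpret cost_rate h lam b0 b1 a K k \<mu>
  proof
    show "lam > 0"
      using mu_pos sigma_pos by (simp add: lam_def)
    show "h x > 0" if "x \<noteq> 0" for x
      using h_convex h_zero h_C1 h_deriv_pos h_deriv_neg that by (rule positive_off_zero)
  qed (use assms in auto)
  obtain z where "z < 0" "g z = h z"
    using ex_g_eq_h by blast
  then have "\<exists>!z. g z = h z" "\<forall>z. g z = h z \<longrightarrow> z < 0"
    using g_eq_h_unique by blast+
  then show ?thesis
    unfolding g_def[symmetric] gamma_def
    using ex_gamma_minimizer gamma_minimizer_location ell_infinity[OF K_right_limit] by blast
qed

end
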